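(* Let $f_a(\ddot q,\dot q,q,t)$, $a=1,\dots,n$, be smooth functions, and let $$r_{ab}=\frac{\partial f_a}{\partial q^b}-\frac{\partial f_b}{\partial q^a}+\frac12\frac{d}{dt}\left(\frac{\partial f_b}{\partial \dot q^a}-\frac{\partial f_a}{\partial \dot q^b}\right),\qquad s_{ab}=\frac12\left(\frac{\partial f_a}{\partial \dot q^b}+\frac{\partial f_b}{\partial \dot q^a}\right)-\frac{d}{dt}\left(\frac{\partial f_b}{\partial \ddot q^a}\right).$$ Then the following two sets of conditions are equivalent. (A) For all $a,b$ the functions $r_{ab}$ and $s_{ab}$ are of first order, and for all $a,b,c$ $$\frac{\partial f_a}{\partial \ddot q^b}=\frac{\partial f_b}{\partial \ddot q^a},\qquad \frac{\partial r_{ab}}{\partial \dot q^c}=\frac{\partial s_{ac}}{\partial q^b}-\frac{\partial s_{bc}}{\partial q^a}.$$ (B) $f_a=g_{ab}\ddot q^b+h_a$ for some smooth first-order functions $g_{ab}$, $h_a$ with $g_{ab}=g_{ba}$ which satisfy, for all $a,b,c$, $$\frac{\partial g_{ab}}{\partial \dot q^c}-\frac{\partial g_{ac}}{\partial \dot q^b}=0,$$ $$\frac{\partial^2 h_a}{\partial \dot q^b\partial \dot q^c}-\frac{\partial^2 h_b}{\partial \dot q^a\partial \dot q^c}=2\left(\frac{\partial g_{ac}}{\partial q^b}-\frac{\partial g_{bc}}{\partial q^a}\right),$$ $$\sum_{a,b,c}\left(\frac{\partial^2 h_a}{\partial q^b\partial \dot q^c}-\frac{\partial^2 h_a}{\partial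 q^c\partial \dot q^b}\right)=0,$$ where $\sum_{a,b,c}$ denotes the cyclic sum over $a,b,c$.
   Context: Indices $a,b,c$ run over $1,\dots,n$ and repeated indices are summed (except that $\sum_{a,b,c}$ denotes, for fixed $a,b,c$, the sum of the three terms obtained by cyclically permuting $(a,b,c)$). The variables $q=(q^a)$ (generalized coordinates), $\dot q=(\dot q^a)$, $\ddot q=(\ddot q^a)$, $\dddot q=(\dddot q^a)$ and $t$ are independent (jet) coordinates; $q$ ranges over an open set $U\subseteq\mathbb{R}^n$, $t$ over an open interval $I\subseteq\mathbb{R}$, and $\dot q,\ddot q,\dddot q$ each over all of $\mathbb{R}^n$. All functions are smooth ($C^\infty$). The total time derivative is $$\frac{d}{dt}=\frac{\partial}{\partial t}+\dot q^c\frac{\partial}{\partial q^c}+\ddot q^c\frac{\partial}{\partial \dot q^c}+\dddot q^c\frac{\partial}{\partial \ddot q^c},$$ so that for $f_a$ depending on $(\ddot q,\dot q,q,t)$ the functions $r_{ab}$, $s_{ab}$ a priori depend on $(\dddot q,\ddot q,\dot q,q,t)$. A function is said to be of first order if it depends only on $(\dot q,q,t)$, i.e. is independent of $\ddot q$ and $\dddot q$. *)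

theory Defs
  imports "HOL-Analysis.Analysis"
begin

text \<open>Jet coordinates are ordered from the highest derivative down:
  \<open>(qd, q, t)\<close>, \<open>(qdd, qd, q, t)\<close> and \<open>(qddd, qdd, qd, q, t)\<close>.  The number of degrees of freedom
  is \<open>CARD('n)\<close>.\<close>

type_synonym 'n jet1 = "(real ^ 'n) \<times> (real ^ 'n) \<times> real"
type_synonym 'n jet2 = "(real ^ 'n) \<times> 'n jet1"
type_synonym 'n jet3 = "(real ^ 'n) \<times> 'n jet2"

definition jet1_dom :: "(real ^ 'n) set \<Rightarrow> real set \<Rightarrow> 'n::finite jet1 set" where
  "jet1_dom U I = UNIV \<times> U \<times> I"

definition jet2_dom :: "(real ^ 'n) set \<Rightarrow> real set \<Rightarrow> 'n::finite jet2 set" where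
  "jet2_dom U I = UNIV \<times> jet1_dom U I"

definition jet3_dom :: "(real ^ 'n) set \<Rightarrow> real set \<Rightarrow> 'n::finite jet3 set" where
  "jet3_dom U I = UNIV \<times> jet2_dom U I"

text \<open>Only meaningful for open \<open>S\<close>, since derivatives are two-sided.\<close>

fun C_on :: "nat \<Rightarrow> 'a::euclidean_space set \<Rightarrow> ('a \<Rightarrow> real) \<Rightarrow> bool" where
  "C_on 0 S F \<longleftrightarrow> continuous_on S F"
| "C_on (Suc k) S F \<longleftrightarrow> (\<forall>x\<in>S. F differentiable (at x)) \<and>
     (\<forall>v. C_on k S (\<lambda>x. frechet_derivative F (at x) v))"

definition smooth_on :: "'a::euclidean_space set \<Rightarrow> ('a \<Rightarrow> real) \<Rightarrow> bool" where
  "smooth_on S F \<longleftrightarrow> (\<forall>k. C_on k S F)"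

text \<open>Derivative along a fixed direction; for a coordinate direction it is the
  corresponding partial derivative.\<close>

definition pd :: "'a::real_normed_vector \<Rightarrow> ('a \<Rightarrow> real) \<Rightarrow> 'a \<Rightarrow> real" where
  "pd v F x = deriv (\<lambda>s. F (x + s *\<^sub>R v)) 0"

text \<open>The digit is the order of the jet space on which the function lives.\<close>

definition pd1_q :: "'n::finite \<Rightarrow> ('n jet1 \<Rightarrow> real) \<Rightarrow> 'n jet1 \<Rightarrow> real" where
  "pd1_q b = pd (0, axis b 1, 0)"

definition pd1_qd :: "'n::finite \<Rightarrow> ('n jet1 \<Rightarrow> real) \<Rightarrow> 'n jet1 \<Rightarrow> real" where
  "pd1_qd b = pd (axis b 1, 0, 0)"

definition pd2_t :: "('n::finite jet2 \<Rightarrow> real) \<Rightarrow> 'n jet2 \<Rightarrow> real" where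
  "pd2_t = pd (0, 0, 0, 1)"

definition pd2_q :: "'n::finite \<Rightarrow> ('n jet2 \<Rightarrow> real) \<Rightarrow> 'n jet2 \<Rightarrow> real" where
  "pd2_q b = pd (0, 0, axis b 1, 0)"

definition pd2_qd :: "'n::finite \<Rightarrow> ('n jet2 \<Rightarrow> real) \<Rightarrow> 'n jet2 \<Rightarrow> real" where
  "pd2_qd b = pd (0, axis b 1, 0, 0)"

definition pd2_qdd :: "'n::finite \<Rightarrow> ('n jet2 \<Rightarrow> real) \<Rightarrow> 'n jet2 \<Rightarrow> real" where
  "pd2_qdd b = pd (axis b 1, 0, 0, 0)"

definition pd3_q :: "'n::finite \<Rightarrow> ('n jet3 \<Rightarrow> real) \<Rightarrow> 'n jet3 \<Rightarrow> real" where
  "pd3_q b = pd (0, 0, 0, axis b 1, 0)"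

definition pd3_qd :: "'n::finite \<Rightarrow> ('n jet3 \<Rightarrow> real) \<Rightarrow> 'n jet3 \<Rightarrow> real" where
  "pd3_qd b = pd (0, 0, axis b 1, 0, 0)"

fun total_deriv :: "('n::finite jet2 \<Rightarrow> real) \<Rightarrow> 'n jet3 \<Rightarrow> real" where
  "total_deriv F (qddd, qdd, qd, q, t) =
     pd2_t F (qdd, qd, q, t)
     + (\<Sum>c\<in>UNIV. qd $ c * pd2_q c F (qdd, qd, q, t))
     + (\<Sum>c\<in>UNIV. qdd $ c * pd2_qd c F (qdd, qd, q, t))
     + (\<Sum>c\<in>UNIV. qddd $ c * pd2_qdd c F (qdd, qd, q, t))"

text \<open>The projection \<open>snd\<close> forgets \<open>qddd\<close>.\<close>

definition r_fun :: "('n::finite \<Rightarrow> 'n jet2 \<Rightarrow> real) \<Rightarrow> 'n \<Rightarrow> 'n \<Rightarrow> 'n jet3 \<Rightarrow> real" where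
  "r_fun f a b x = pd2_q b (f a) (snd x) - pd2_q a (f b) (snd x)
     + 1 / 2 * total_deriv (\<lambda>y. pd2_qd a (f b) y - pd2_qd b (f a) y) x"

definition s_fun :: "('n::finite \<Rightarrow> 'n jet2 \<Rightarrow> real) \<Rightarrow> 'n \<Rightarrow> 'n \<Rightarrow> 'n jet3 \<Rightarrow> real" where
  "s_fun f a b x = 1 / 2 * (pd2_qd b (f a) (snd x) + pd2_qd a (f b) (snd x))
     - total_deriv (pd2_qdd a (f b)) x"

definition first_order_on :: "'n::finite jet3 set \<Rightarrow> ('n jet3 \<Rightarrow> real) \<Rightarrow> bool" where
  "first_order_on D F \<longleftrightarrow>
     (\<forall>qddd qdd qddd' qdd' qd q t.
        (qddd, qdd, qd, q, t) \<in> D \<longrightarrow> (qddd', qdd', qd, q, t) \<in> D \<longrightarrow>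
        F (qddd, qdd, qd, q, t) = F (qddd', qdd', qd, q, t))"

definition cyclic_sum :: "('n \<Rightarrow> 'n \<Rightarrow> 'n \<Rightarrow> real) \<Rightarrow> 'n \<Rightarrow> 'n \<Rightarrow> 'n \<Rightarrow> real" where
  "cyclic_sum T a b c = T a b c + T b c a + T c a b"

end

theory Submission
  imports Defs
begin

text \<open>
  Being linear in \<open>qddd\<close>, \<open>s\<^sub>a\<^sub>b\<close> can be of first order only if its \<open>qddd\<^sup>c\<close>-coefficient
  \<open>-\<partial>\<^sup>2f\<^sub>b/\<partial>qdd\<^sup>a\<partial>qdd\<^sup>c\<close> vanishes, which makes \<open>f\<close> affine in \<open>qdd\<close>: \<open>f\<^sub>a = g\<^sub>a\<^sub>b qdd\<^sup>b + h\<^sub>a\<close>.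
  For such \<open>f\<close> with \<open>g\<close> symmetric, the \<open>qddd\<close>-coefficient of \<open>r\<close> is the curl of \<open>g\<close> in \<open>qd\<close>, whose
  vanishing is the first condition on \<open>(g, h)\<close> and makes \<open>s\<close> of first order; the \<open>qdd\<close>-coefficient
  of \<open>r\<close> is then half the defect of the second condition.  When both hold, differentiating the
  remaining first-order parts of \<open>r\<close> and \<open>s\<close> shows that
  \<open>\<partial>r\<^sub>a\<^sub>b/\<partial>qd\<^sup>c - \<partial>s\<^sub>a\<^sub>c/\<partial>q\<^sup>b + \<partial>s\<^sub>b\<^sub>c/\<partial>q\<^sup>a\<close> is half the cyclic sum of the third condition.
\<close>

subsection \<open>Directional derivatives of smooth functions\<close>

lemma has_derivative_imp_pd_DERIV:
  assumes "(F has_derivative F') (at x)"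
  shows "((\<lambda>s. F (x + s *\<^sub>R v)) has_real_derivative F' v) (at 0)"
proof -
  have "((\<lambda>s. x + s *\<^sub>R v) has_derivative (\<lambda>s. s *\<^sub>R v)) (at (0::real))"
    by (auto intro!: derivative_eq_intros)
  then have "(F \<circ> (\<lambda>s. x + s *\<^sub>R v) has_derivative F' \<circ> (\<lambda>s. s *\<^sub>R v)) (at 0)"
    using assms by (intro diff_chain_at) simp_all
  moreover have "F' \<circ> (\<lambda>s. s *\<^sub>R v) = (*) (F' v)"
    using has_derivative_linear[OF assms] by (auto simp: linear_cmul)
  ultimately show ?thesis
    by (simp add: has_field_derivative_def o_def)
qed

lemma pd_has_derivative: "(F has_derivative F') (at x) \<Longrightarrow> pd v F x = F' v"
  unfolding pd_def by (intro DERIV_imp_deriv has_derivative_imp_pd_DERIV)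

lemma pd_eq_frechet_derivative:
  "F differentiable (at x) \<Longrightarrow> pd v F x = frechet_derivative F (at x) v"
  by (rule pd_has_derivative[OF iffD1[OF frechet_derivative_works]])

text \<open>\<open>pd\<close> only sees one line at a time; differentiability assembles these line
  derivatives into the Frechet derivative, which makes linearity in the direction available.\<close>

lemma has_derivative_pd:
  "F differentiable (at x) \<Longrightarrow> (F has_derivative (\<lambda>v. pd v F x)) (at x)"
  using frechet_derivative_works[of F "at x"] by (simp add: pd_eq_frechet_derivative)

lemma linear_pd: "F differentiable (at x) \<Longrightarrow> linear (\<lambda>v. pd v F x)"
  by (rule has_derivative_linear[OF has_derivative_pd])

lemma pd_DERIV_line:
  assumes "F differentiable (at (x + s *\<^sub>R v))"
  shows "((\<lambda>s. F (x + s *\<^sub>R v)) has_real_derivative pd v F (x + s *\<^sub>R v)) (at s)"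
  using DERIV_shift[of "\<lambda>s. F (x + s *\<^sub>R v)" _ 0 s]
    has_derivative_imp_pd_DERIV[OF has_derivative_pd[OF assms], of v]
  by (simp add: algebra_simps)

text \<open>A short segment of the line through \<open>x\<close> stays in the open set, so only
  values near \<open>x\<close> matter. This lets identities known only on the jet domain be
  differentiated.\<close>

lemma pd_cong:
  assumes "open S" "x \<in> S" "\<And>y. y \<in> S \<Longrightarrow> F y = G y"
  shows "pd v F x = pd v G x"
  unfolding pd_def
proof (rule deriv_cong_ev)
  have "((\<lambda>s. x + s *\<^sub>R v) \<longlongrightarrow> x + 0 *\<^sub>R v) (nhds (0::real))"
    by (intro tendsto_intros filterlim_ident)
  then have "\<forall>\<^sub>F s in nhds (0::real). x + s *\<^sub>R v \<in> S"
    using assms(1,2) by (auto dest: topological_tendstoD)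
  then show "\<forall>\<^sub>F s in nhds 0. F (x + s *\<^sub>R v) = G (x + s *\<^sub>R v)"
    by eventually_elim (use assms in auto)
qed simp

lemma pd_add:
  "F differentiable (at x) \<Longrightarrow> G differentiable (at x) \<Longrightarrow>
    pd v (\<lambda>y. F y + G y) x = pd v F x + pd v G x"
  by (rule pd_has_derivative[OF has_derivative_add[OF has_derivative_pd has_derivative_pd]])

lemma pd_diff:
  "F differentiable (at x) \<Longrightarrow> G differentiable (at x) \<Longrightarrow>
    pd v (\<lambda>y. F y - G y) x = pd v F x - pd v G x"
  by (rule pd_has_derivative[OF has_derivative_diff[OF has_derivative_pd has_derivative_pd]])

lemma pd_cmult:
  "F differentiable (at x) \<Longrightarrow> pd v (\<lambda>y. c * F y) x = c * pd v F x"
  by (rule pd_has_derivative[OF has_derivative_mult_right[OF has_derivative_pd]])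

lemma pd_const: "pd v (\<lambda>y. c) x = 0"
  by (rule pd_has_derivative[OF has_derivative_const])

lemma pd_divide:
  "F differentiable (at x) \<Longrightarrow> pd v (\<lambda>y. F y / c) x = pd v F x / c"
  using pd_cmult[of F x v "inverse c"] by (simp add: divide_inverse mult.commute)

lemma pd_eq_0_on_open:
  assumes "open S" "x \<in> S" "\<And>y. y \<in> S \<Longrightarrow> F y = 0"
  shows "pd v F x = 0"
  using pd_cong[of S x F "\<lambda>_. 0" v] assms by (simp add: pd_const)

lemma pd_mult:
  "F differentiable (at x) \<Longrightarrow> G differentiable (at x) \<Longrightarrow>
    pd v (\<lambda>y. F y * G y) x = F x * pd v G x + pd v F x * G x"
  by (rule pd_has_derivative[OF has_derivative_mult[OF has_derivative_pd has_derivative_pd]])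

lemma pd_sum:
  "(\<And>i. i \<in> A \<Longrightarrow> F i differentiable (at x)) \<Longrightarrow>
    pd v (\<lambda>y. \<Sum>i\<in>A. F i y) x = (\<Sum>i\<in>A. pd v (F i) x)"
  by (rule pd_has_derivative[OF has_derivative_sum[OF has_derivative_pd]])

lemma differentiable_cong_open:
  assumes "F differentiable (at x)" "open S" "x \<in> S" "\<And>y. y \<in> S \<Longrightarrow> F y = G y"
  shows "G differentiable (at x)"
  using assms(1) has_derivative_transform_within_open[of F _ x UNIV S G, OF _ assms(2-4)]
  unfolding differentiable_def by blast

section \<open>Smoothness under local equality, linear substitution and differentiation\<close>

lemma C_on_cong:
  assumes "open S"
  shows "C_on k S F \<Longrightarrow> (\<And>x. x \<in> S \<Longrightarrow> F x = G x) \<Longrightarrow> C_on k S G"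
proof (induction k arbitrary: F G)
  case 0
  then show ?case by (simp cong: continuous_on_cong)
next
  case (Suc k)
  have d: "F differentiable (at x)" "G differentiable (at x)" if "x \<in> S" for x
    using Suc.prems that differentiable_cong_open[OF _ assms, of F x G] by auto
  have "frechet_derivative F (at x) v = frechet_derivative G (at x) v" if "x \<in> S" for x v
    using d[OF that] pd_cong[OF assms that Suc.prems(2)] by (simp flip: pd_eq_frechet_derivative)
  then have "C_on k S (\<lambda>x. frechet_derivative G (at x) v)" for v
    using Suc.prems(1) by (auto intro: Suc.IH[of "\<lambda>x. frechet_derivative F (at x) v"])
  then show ?case
    using d by auto
qed

text \<open>Because \<open>L\<close> is linear, the chain rule turns the fixed direction
  \<open>v\<close> into the fixed direction \<open>L v\<close>, so the induction hypothesis applies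
  again to the derivative of \<open>F\<close> along \<open>L v\<close>.\<close>

lemma C_on_compose_linear:
  fixes L :: "'b::euclidean_space \<Rightarrow> 'a::euclidean_space"
  assumes "open T" "bounded_linear L" "\<And>x. x \<in> T \<Longrightarrow> L x \<in> S"
  shows "C_on k S F \<Longrightarrow> C_on k T (\<lambda>x. F (L x))"
proof (induction k arbitrary: F)
  case 0
  then show ?case
    using assms continuous_on_compose2[of S F T L] linear_continuous_on by auto
next
  case (Suc k)
  have d: "((\<lambda>x. F (L x)) has_derivative (\<lambda>v. frechet_derivative F (at (L x)) (L v))) (at x)"
    if "x \<in> T" for x
  proof -
    have "(F has_derivative frechet_derivative F (at (L x))) (at (L x))"
      using Suc.prems assms(3)[OF that] frechet_derivative_works by auto
    from has_derivative_compose[OF bounded_linear_imp_has_derivative[OF assms(2)] this]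
    show ?thesis .
  qed
  have "C_on k T (\<lambda>x. frechet_derivative (\<lambda>x. F (L x)) (at x) v)" for v
  proof (rule C_on_cong[OF assms(1)])
    show "C_on k T (\<lambda>x. frechet_derivative F (at (L x)) (L v))"
      using Suc.prems by (intro Suc.IH) auto
    show "frechet_derivative F (at (L x)) (L v) = frechet_derivative (\<lambda>x. F (L x)) (at x) v"
      if "x \<in> T" for x
      using frechet_derivative_at[OF d[OF that]] by metis
  qed
  then show ?case
    using d by (auto simp: differentiable_def)
qed

lemma smooth_on_compose_linear:
  fixes L :: "'b::euclidean_space \<Rightarrow> 'a::euclidean_space"
  assumes "smooth_on S F" "open T" "bounded_linear L" "\<And>x. x \<in> T \<Longrightarrow> L x \<in> S"
  shows "smooth_on T (\<lambda>x. F (L x))"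
  using assms(1) C_on_compose_linear[OF assms(2-4)] unfolding smooth_on_def by blast

lemma smooth_on_imp_differentiable:
  "smooth_on S F \<Longrightarrow> x \<in> S \<Longrightarrow> F differentiable (at x)"
  unfolding smooth_on_def by (metis C_on.simps(2))

lemma smooth_on_imp_continuous_on: "smooth_on S F \<Longrightarrow> continuous_on S F"
  unfolding smooth_on_def by (metis C_on.simps(1))

lemma smooth_on_pd:
  assumes "open S" "smooth_on S F"
  shows "smooth_on S (pd v F)"
  unfolding smooth_on_def
proof
  fix k
  have "C_on (Suc k) S F"
    using assms unfolding smooth_on_def by blast
  then show "C_on k S (pd v F)"
    by (auto simp: pd_eq_frechet_derivative
        intro: C_on_cong[OF assms(1), of k "\<lambda>x. frechet_derivative F (at x) v"])
qed

text \<open>The second difference quotient is a value of the mixed derivative near the base point,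
  by applying the mean value theorem once in each direction.\<close>

lemma second_difference_mean_value:
  assumes "s > 0"
    and dom: "\<And>\<xi> \<eta>. 0 \<le> \<xi> \<Longrightarrow> \<xi> \<le> s \<Longrightarrow> 0 \<le> \<eta> \<Longrightarrow> \<eta> \<le> s \<Longrightarrow> x + \<xi> *\<^sub>R v + \<eta> *\<^sub>R w \<in> S"
    and "\<And>y. y \<in> S \<Longrightarrow> F differentiable (at y)" "\<And>y. y \<in> S \<Longrightarrow> pd v F differentiable (at y)"
  obtains \<xi> \<eta> where "0 < \<xi>" "\<xi> < s" "0 < \<eta>" "\<eta> < s"
    "F (x + s *\<^sub>R v + s *\<^sub>R w) - F (x + s *\<^sub>R v) - F (x + s *\<^sub>R w) + F x
       = s * s * pd w (pd v F) (x + \<xi> *\<^sub>R v + \<eta> *\<^sub>R w)"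
proof -
  let ?\<phi> = "\<lambda>u. F ((x + s *\<^sub>R w) + u *\<^sub>R v) - F (x + u *\<^sub>R v)"
  let ?\<phi>' = "\<lambda>u. pd v F ((x + s *\<^sub>R w) + u *\<^sub>R v) - pd v F (x + u *\<^sub>R v)"
  have "(?\<phi> has_real_derivative ?\<phi>' u) (at u)" if "0 \<le> u" "u \<le> s" for u
    using dom[of u s] dom[of u 0] that assms
    by (intro DERIV_diff pd_DERIV_line) (auto simp: algebra_simps)
  then obtain \<xi> where \<xi>: "0 < \<xi>" "\<xi> < s" "?\<phi> s - ?\<phi> 0 = (s - 0) * ?\<phi>' \<xi>"
    using MVT2[OF assms(1), of ?\<phi> ?\<phi>'] by blast
  let ?\<psi> = "\<lambda>u. pd v F (x + \<xi> *\<^sub>R v + u *\<^sub>R w)"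
  have "(?\<psi> has_real_derivative pd w (pd v F) (x + \<xi> *\<^sub>R v + u *\<^sub>R w)) (at u)"
    if "0 \<le> u" "u \<le> s" for u
    using dom[of \<xi> u] that \<xi> assms by (intro pd_DERIV_line) auto
  then obtain \<eta> where \<eta>: "0 < \<eta>" "\<eta> < s"
      "?\<psi> s - ?\<psi> 0 = (s - 0) * pd w (pd v F) (x + \<xi> *\<^sub>R v + \<eta> *\<^sub>R w)"
    using MVT2[OF assms(1), of ?\<psi> "\<lambda>u. pd w (pd v F) (x + \<xi> *\<^sub>R v + u *\<^sub>R w)"] by blast
  have "?\<phi>' \<xi> = ?\<psi> s - ?\<psi> 0"
    by (simp add: algebra_simps)
  then have "?\<phi> s - ?\<phi> 0 = s * (s * pd w (pd v F) (x + \<xi> *\<^sub>R v + \<eta> *\<^sub>R w))"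
    using \<xi>(3) \<eta>(3) by simp
  then show thesis
    using that[OF \<xi>(1,2) \<eta>(1,2)] by (simp add: algebra_simps)
qed

text \<open>The second difference is symmetric in \<open>v\<close> and \<open>w\<close>, so the mean
  value form in either order gives values of the two mixed derivatives that coincide at points near
  \<open>x\<close>; continuity carries the equality to \<open>x\<close>.\<close>

lemma pd_commute:
  fixes F :: "'a::euclidean_space \<Rightarrow> real"
  assumes S: "open S" "smooth_on S F" "x \<in> S"
  shows "pd v (pd w F) x = pd w (pd v F) x"
proof -
  have cont: "isCont (pd a (pd b F)) x" for a b
    using S smooth_on_imp_continuous_on[OF smooth_on_pd[OF S(1) smooth_on_pd[OF S(1,2)]]]
    by (simp add: continuous_on_eq_continuous_at)
  have df: "F differentiable (at y)" "pd a F differentiable (at y)" if "y \<in> S" for a y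
    using that S smooth_on_imp_differentiable smooth_on_pd by blast+
  obtain r where r: "r > 0" "ball x r \<subseteq> S"
    using S(1,3) open_contains_ball by blast
  have bound: "\<bar>pd v (pd w F) x - pd w (pd v F) x\<bar> < e" if "e > 0" for e
  proof -
    obtain d1 where d1: "d1 > 0" "\<And>y. dist y x < d1 \<Longrightarrow> dist (pd v (pd w F) y) (pd v (pd w F) x) < e/2"
      using cont[of v w] \<open>e > 0\<close> unfolding continuous_at_eps_delta by (metis half_gt_zero)
    obtain d2 where d2: "d2 > 0" "\<And>y. dist y x < d2 \<Longrightarrow> dist (pd w (pd v F) y) (pd w (pd v F) x) < e/2"
      using cont[of w v] \<open>e > 0\<close> unfolding continuous_at_eps_delta by (metis half_gt_zero)
    define d where "d = min r (min d1 d2)"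
    \<comment> \<open>The size is chosen so that the whole parallelogram with sides
      \<open>s *\<^sub>R v\<close> and \<open>s *\<^sub>R w\<close> lies within \<open>d\<close> of
      \<open>x\<close>; the summand 1 keeps the denominator positive for zero directions.\<close>
    define s where "s = d / (norm v + norm w + 1)"
    have npos: "norm v + norm w + 1 > 0"
      by (simp add: add_nonneg_pos)
    have "d > 0" using r d1 d2 by (simp add: d_def)
    then have "s > 0" using npos by (simp add: s_def)
    have near: "dist (x + a *\<^sub>R v + b *\<^sub>R w) x < d"
      if "0 \<le> a" "a \<le> s" "0 \<le> b" "b \<le> s" for a b
    proof -
      have "norm (a *\<^sub>R v + b *\<^sub>R w) \<le> a * norm v + b * norm w"
        using norm_triangle_ineq[of "a *\<^sub>R v" "b *\<^sub>R w"] that by simp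
      also have "\<dots> \<le> s * norm v + s * norm w"
        using that by (intro add_mono mult_right_mono) auto
      also have "\<dots> < s * (norm v + norm w + 1)"
        using \<open>s > 0\<close> by (simp add: algebra_simps)
      also have "\<dots> = d"
        using npos by (simp add: s_def)
      finally show ?thesis
        by (simp add: dist_norm add.assoc)
    qed
    have inS: "x + a *\<^sub>R v + b *\<^sub>R w \<in> S" "x + b *\<^sub>R w + a *\<^sub>R v \<in> S"
      if "0 \<le> a" "a \<le> s" "0 \<le> b" "b \<le> s" for a b
      using near[OF that] r by (auto simp: d_def dist_commute algebra_simps)
    obtain a b where ab: "0 < a" "a < s" "0 < b" "b < s"
      "F (x + s *\<^sub>R v + s *\<^sub>R w) - F (x + s *\<^sub>R v) - F (x + s *\<^sub>R w) + F x
         = s * s * pd w (pd v F) (x + a *\<^sub>R v + b *\<^sub>R w)"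
      by (rule second_difference_mean_value[of s x v w S F]) (auto intro: \<open>s > 0\<close> inS df)
    obtain a' b' where ab': "0 < b'" "b' < s" "0 < a'" "a' < s"
      "F (x + s *\<^sub>R w + s *\<^sub>R v) - F (x + s *\<^sub>R w) - F (x + s *\<^sub>R v) + F x
         = s * s * pd v (pd w F) (x + b' *\<^sub>R w + a' *\<^sub>R v)"
      by (rule second_difference_mean_value[of s x w v S F]) (auto intro: \<open>s > 0\<close> inS df)
    have "s * s * pd w (pd v F) (x + a *\<^sub>R v + b *\<^sub>R w)
        = s * s * pd v (pd w F) (x + a' *\<^sub>R v + b' *\<^sub>R w)"
      unfolding ab(5)[symmetric] using ab'(5) by (simp add: algebra_simps)
    then have "pd w (pd v F) (x + a *\<^sub>R v + b *\<^sub>R w) = pd v (pd w F) (x + a' *\<^sub>R v + b' *\<^sub>R w)"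
      using \<open>s > 0\<close> by simp
    moreover have "dist (x + a *\<^sub>R v + b *\<^sub>R w) x < d2" "dist (x + a' *\<^sub>R v + b' *\<^sub>R w) x < d1"
      using near[of a b] near[of a' b'] ab ab' by (auto simp: d_def)
    ultimately show ?thesis
      using d1(2) d2(2) by (smt (verit, best) dist_real_def field_sum_of_halves)
  qed
  \<comment> \<open>A nonzero difference would be strictly smaller than its own absolute
    value.\<close>
  show ?thesis
    using bound[of "\<bar>pd v (pd w F) x - pd w (pd v F) x\<bar>"] by fastforce
qed

subsection \<open>The total derivative on jet space\<close>

text \<open>Linearity in the direction. \<open>T\<close> embeds one block of coordinates into the
  jet space, so a sum over the partial derivatives of that block becomes a single directional
  derivative.\<close>

lemma pd_axis_expansion:
  fixes T :: "real ^ 'n::finite \<Rightarrow> 'a::real_normed_vector"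
  assumes "G differentiable (at x)" "linear T"
  shows "(\<Sum>c\<in>UNIV. w $ c * pd (T (axis c 1)) G x) = pd (T w) G x"
proof -
  have lin: "linear (\<lambda>w. pd (T w) G x)"
    using linear_compose[OF assms(2) linear_pd[OF assms(1)]] by (simp add: o_def)
  have "pd (T w) G x = pd (T (\<Sum>c\<in>UNIV. w $ c *\<^sub>R axis c 1)) G x"
    using basis_expansion[of w] by (simp add: scalar_mult_eq_scaleR)
  also have "\<dots> = (\<Sum>c\<in>UNIV. w $ c * pd (T (axis c 1)) G x)"
    by (simp add: linear_sum[OF lin] linear_cmul[OF lin])
  finally show ?thesis ..
qed

lemma pd1_q_expansion:
  assumes "G differentiable (at x)"
  shows "(\<Sum>c\<in>UNIV. w $ c * pd1_q c G x) = pd (0, w, 0) G x"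
  unfolding pd1_q_def
  by (rule pd_axis_expansion[OF assms, of "\<lambda>w. (0, w, 0)"]) (auto intro!: linearI)

lemma pd1_qd_expansion:
  assumes "G differentiable (at x)"
  shows "(\<Sum>c\<in>UNIV. w $ c * pd1_qd c G x) = pd (w, 0, 0) G x"
  unfolding pd1_qd_def
  by (rule pd_axis_expansion[OF assms, of "\<lambda>w. (w, 0, 0)"]) (auto intro!: linearI)

lemma pd2_qdd_expansion:
  assumes "G differentiable (at x)"
  shows "(\<Sum>c\<in>UNIV. w $ c * pd2_qdd c G x) = pd (w, 0, 0, 0) G x"
  unfolding pd2_qdd_def
  by (rule pd_axis_expansion[OF assms, of "\<lambda>w. (w, 0, 0, 0)"]) (auto intro!: linearI)

lemma pd_add_direction:
  "G differentiable (at x) \<Longrightarrow> pd (u + v) G x = pd u G x + pd v G x"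
  using linear_add[OF linear_pd] .

text \<open>The four sums of the total derivative are the blocks of one direction
  \<open>(qddd, qdd, qd, 1)\<close>, recombined by additivity. The calculus of \<open>pd\<close>
  then replaces the coordinate sums.\<close>

lemma total_deriv_eq_pd:
  assumes "F differentiable (at (p, x))"
  shows "total_deriv F (w, p, x) = pd (w, p, fst x, 1) F (p, x)"
proof -
  obtain qd q t where x: "x = (qd, q, t)"
    by (metis prod.exhaust)
  have q: "(\<Sum>c\<in>UNIV. qd $ c * pd2_q c F (p, x)) = pd (0, 0, qd, 0) F (p, x)"
    unfolding pd2_q_def
    by (rule pd_axis_expansion[OF assms, of "\<lambda>w. (0, 0, w, 0)"]) (auto intro!: linearI)
  have qd: "(\<Sum>c\<in>UNIV. p $ c * pd2_qd c F (p, x)) = pd (0, p, 0, 0) F (p, x)"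
    unfolding pd2_qd_def
    by (rule pd_axis_expansion[OF assms, of "\<lambda>w. (0, w, 0, 0)"]) (auto intro!: linearI)
  have "pd (w, p, qd, 1) F (p, x)
      = pd ((0, 0, 0, 1) + (0, 0, qd, 0) + (0, p, 0, 0) + (w, 0, 0, 0)) F (p, x)"
    by simp
  also have "\<dots> = total_deriv F (w, p, x)"
    using pd2_qdd_expansion[OF assms] q qd
    unfolding pd_add_direction[OF assms] by (simp add: x pd2_t_def)
  finally show ?thesis
    by (simp add: x)
qed

text \<open>The part \<open>\<partial>\<^sub>t + qd\<^sup>c \<partial>\<^sub>q\<^sub>c\<close> of the total derivative that preserves first order.\<close>

definition drift :: "('n::finite jet1 \<Rightarrow> real) \<Rightarrow> 'n jet1 \<Rightarrow> real" where
  "drift G x = pd (0, fst x, 1) G x"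

lemma pd_total_direction:
  assumes "G differentiable (at x)"
  shows "pd (p, fst x, 1) G x = drift G x + (\<Sum>c\<in>UNIV. p $ c * pd1_qd c G x)"
proof -
  have "pd (p, fst x, 1) G x = pd ((0, fst x, 1) + (p, 0, 0)) G x"
    by simp
  then show ?thesis
    unfolding pd_add_direction[OF assms] pd1_qd_expansion[OF assms] drift_def .
qed

lemma drift_expansion:
  assumes "G differentiable (at x)"
  shows "drift G x = pd (0, 0, 1) G x + (\<Sum>c\<in>UNIV. fst x $ c * pd1_q c G x)"
proof -
  have "drift G x = pd ((0, 0, 1) + (0, fst x, 0)) G x"
    by (simp add: drift_def)
  then show ?thesis
    unfolding pd_add_direction[OF assms] pd1_q_expansion[OF assms] .
qed

lemma has_derivative_fst_nth:
  "((\<lambda>y. fst y $ c) has_derivative (\<lambda>v. fst v $ c)) (at x)"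
  by (rule bounded_linear_imp_has_derivative
      [OF bounded_linear_compose[OF bounded_linear_vec_nth bounded_linear_fst]])

lemma fst_nth_differentiable [simp]: "(\<lambda>y. fst y $ c) differentiable (at x)"
  using has_derivative_fst_nth differentiableI by blast

lemma pd_fst_nth: "pd v (\<lambda>y. fst y $ c) x = fst v $ c"
  by (rule pd_has_derivative[OF has_derivative_fst_nth])

text \<open>The direction of \<open>drift\<close> varies with the point through its velocity block.
  Expanding it into fixed directions leaves commuting derivatives, and the product rule on the
  coefficients \<open>fst y $ c\<close> yields the commutator term along \<open>q\<close>.\<close>

lemma
  fixes G :: "'n::finite jet1 \<Rightarrow> real"
  assumes S: "open S" "smooth_on S G" "x \<in> S"
  shows pd_drift: "pd v (drift G) x = drift (pd v G) x + pd (0, fst v, 0) G x"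
    and drift_differentiable: "drift G differentiable (at x)"
proof -
  let ?E = "\<lambda>y. pd (0, 0, 1) G y + (\<Sum>c\<in>UNIV. fst y $ c * pd1_q c G y)"
  have eq: "?E y = drift G y" if "y \<in> S" for y
    using drift_expansion[OF smooth_on_imp_differentiable[OF S(2) that]] by simp
  have d: "pd u G differentiable (at x)" "pd1_q c G differentiable (at x)" for u c
    unfolding pd1_q_def using S smooth_on_imp_differentiable smooth_on_pd by blast+
  show "drift G differentiable (at x)"
  proof (rule differentiable_cong_open[of ?E])
    show "?E differentiable (at x)"
      by (auto intro!: differentiable_add differentiable_sum differentiable_mult d)
  qed (use S eq in auto)
  have "pd v (drift G) x = pd v ?E x"
    by (rule pd_cong[OF S(1,3)]) (simp add: eq)
  also have "\<dots> = pd v (pd (0, 0, 1) G) x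
      + (\<Sum>c\<in>UNIV. fst x $ c * pd v (pd1_q c G) x + fst v $ c * pd1_q c G x)"
    using d by (simp add: pd_add pd_sum pd_mult pd_fst_nth differentiable_mult differentiable_sum)
  also have "\<dots> = pd (0, 0, 1) (pd v G) x + (\<Sum>c\<in>UNIV. fst x $ c * pd1_q c (pd v G) x)
      + (\<Sum>c\<in>UNIV. fst v $ c * pd1_q c G x)"
    unfolding pd1_q_def by (simp add: pd_commute[OF S, of v] sum.distrib)
  also have "\<dots> = drift (pd v G) x + pd (0, fst v, 0) G x"
    by (simp add: drift_expansion[OF d(1)]
        pd1_q_expansion[OF smooth_on_imp_differentiable[OF S(2,3)]])
  finally show "pd v (drift G) x = drift (pd v G) x + pd (0, fst v, 0) G x" .
qed

section \<open>Functions affine in the acceleration\<close>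

lemma
  fixes F :: "'n::finite jet2 \<Rightarrow> real"
  assumes S: "open S" "x \<in> S"
    and F: "\<And>p y. y \<in> S \<Longrightarrow> F (p, y) = (\<Sum>c\<in>UNIV. G c y * p $ c) + H y"
    and d: "\<And>c. G c differentiable (at x)" "H differentiable (at x)"
  shows pd_affine: "pd (w, v) F (p, x)
      = (\<Sum>c\<in>UNIV. pd v (G c) x * p $ c + G c x * w $ c) + pd v H x"
    and affine_differentiable: "F differentiable (at (p, x))"
proof -
  let ?A = "\<lambda>z::'n jet2. (\<Sum>c\<in>UNIV. G c (snd z) * fst z $ c) + H (snd z)"
  let ?A' = "\<lambda>u::'n jet2. (\<Sum>c\<in>UNIV. G c x * fst u $ c + pd (snd u) (G c) x * p $ c) + pd (snd u) H x"
  have snd: "((\<lambda>z. K (snd z)) has_derivative (\<lambda>u. pd (snd u) K x)) (at (p, x))"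
    if "K differentiable (at x)" for K
    by (rule has_derivative_compose[OF bounded_linear_imp_has_derivative[OF bounded_linear_snd]])
       (use has_derivative_pd[OF that] in simp)
  have "(?A has_derivative ?A') (at (p, x))"
    using has_derivative_add[OF has_derivative_sum[OF
          has_derivative_mult[OF snd[OF d(1)] has_derivative_fst_nth]] snd[OF d(2)]]
    by simp
  moreover have "open (UNIV \<times> S)" "(p, x) \<in> UNIV \<times> S" "\<And>z. z \<in> UNIV \<times> S \<Longrightarrow> ?A z = F z"
    using S F by (auto intro: open_Times)
  ultimately have *: "(F has_derivative ?A') (at (p, x))"
    by (rule has_derivative_transform_within_open)
  then show "F differentiable (at (p, x))"
    by (rule differentiableI)
  show "pd (w, v) F (p, x) = (\<Sum>c\<in>UNIV. pd v (G c) x * p $ c + G c x * w $ c) + pd v H x"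
    using pd_has_derivative[OF *, of "(w, v)"] by (simp add: add.commute)
qed

text \<open>Integrate twice along the ray from 0 to \<open>p\<close>, which stays in the domain
  because accelerations range over the whole space: the first derivatives are constant there, hence
  \<open>F\<close> is its first-order Taylor polynomial at zero acceleration.\<close>

lemma affine_of_second_derivative_zero:
  fixes F :: "'n::finite jet2 \<Rightarrow> real"
  assumes S: "open S" "smooth_on (UNIV \<times> S) F" "x \<in> S"
    and zero: "\<And>a c p. pd2_qdd c (pd2_qdd a F) (p, x) = 0"
  shows "F (p, x) = (\<Sum>b\<in>UNIV. pd2_qdd b F (0, x) * p $ b) + F (0, x)"
proof -
  have o: "open (UNIV \<times> S)"
    using S by (intro open_Times) auto
  have d: "F differentiable (at (p, x))" "pd2_qdd b F differentiable (at (p, x))" for p b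
    unfolding pd2_qdd_def
    using S smooth_on_imp_differentiable smooth_on_pd[OF o S(2)] by (metis UNIV_I mem_Times_iff fst_conv snd_conv)+
  have line: "((\<lambda>s. G (s *\<^sub>R p, x)) has_real_derivative (\<Sum>c\<in>UNIV. p $ c * pd2_qdd c G (s *\<^sub>R p, x))) (at s)"
    if "\<And>p. G differentiable (at (p, x))" for G p s
    using pd_DERIV_line[of G "(0, x)" s "(p, 0, 0, 0)"] that
    by (simp add: pd2_qdd_expansion flip: zero_prod_def)
  have const: "pd2_qdd b F (p, x) = pd2_qdd b F (0, x)" for p b
    using DERIV_isconst_all[of "\<lambda>s. pd2_qdd b F (s *\<^sub>R p, x)" 1 0] line[OF d(2)[of b]]
    by (simp add: zero)
  let ?k = "\<Sum>c\<in>UNIV. p $ c * pd2_qdd c F (0, x)"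
  \<comment> \<open>\<open>?k\<close> is the slope of \<open>F\<close> along the ray at its start;
    constancy of the first derivatives makes it the slope at every \<open>s\<close>.\<close>
  have "((\<lambda>s. F (s *\<^sub>R p, x) - ?k * s) has_real_derivative 0) (at s)" for s
    using line[OF d(1), of p s] by (auto intro!: derivative_eq_intros simp: const[of _ "s *\<^sub>R p"])
  then have "F (1 *\<^sub>R p, x) - ?k * 1 = F (0 *\<^sub>R p, x) - ?k * 0"
    by (intro DERIV_isconst_all[of "\<lambda>s. F (s *\<^sub>R p, x) - ?k * s"]) blast
  then show ?thesis
    by (simp add: mult.commute)
qed

subsection \<open>Forces affine in the acceleration\<close>

lemma sum_mult_axis: "(\<Sum>c\<in>UNIV. k c * axis d 1 $ c) = (k d :: real)"
proof -
  have "(\<Sum>c\<in>UNIV. k c * axis d 1 $ c) = (\<Sum>c\<in>UNIV. if c = d then k c else 0)"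
    by (intro sum.cong) (auto simp: axis_def)
  then show ?thesis by simp
qed

text \<open>Both (A) and (B) lead to this setting, with symmetry of \<open>g\<close> taken from the
  symmetry condition on \<open>f\<close> or on \<open>g\<close> respectively. One equivalence proved
  here thus serves both implications.\<close>

locale affine_force =
  fixes S :: "'n::finite jet1 set"
    and f :: "'n \<Rightarrow> 'n jet2 \<Rightarrow> real"
    and g :: "'n \<Rightarrow> 'n \<Rightarrow> 'n jet1 \<Rightarrow> real"
    and h :: "'n \<Rightarrow> 'n jet1 \<Rightarrow> real"
  assumes open_S: "open S"
    and smooth_g: "\<And>a b. smooth_on S (g a b)"
    and smooth_h: "\<And>a. smooth_on S (h a)"
    and f_eq: "\<And>a p x. x \<in> S \<Longrightarrow> f a (p, x) = (\<Sum>b\<in>UNIV. g a b x * p $ b) + h a x"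
    and g_sym: "\<And>a b x. x \<in> S \<Longrightarrow> g a b x = g b a x"
begin

lemma smooth_pd_h: "smooth_on S (pd v (h a))"
  by (intro smooth_on_pd open_S smooth_h)

lemma differentiable_coeffs:
  assumes "x \<in> S"
  shows "g a b differentiable (at x)" "h a differentiable (at x)"
    "pd v (g a b) differentiable (at x)" "pd v (h a) differentiable (at x)"
    "pd u (pd v (g a b)) differentiable (at x)" "pd u (pd v (h a)) differentiable (at x)"
  using assms
  by (auto intro!: smooth_on_imp_differentiable[of S] smooth_on_pd open_S smooth_g smooth_h)

lemma pd_g_sym: "x \<in> S \<Longrightarrow> pd v (g a b) x = pd v (g b a) x"
  by (rule pd_cong[OF open_S _ g_sym])

lemma pd_f:
  assumes "x \<in> S"
  shows "pd (0, v) (f a) (p, x) = (\<Sum>c\<in>UNIV. pd v (g a c) x * p $ c) + pd v (h a) x"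
  using pd_affine[where F = "f a" and w = 0, OF open_S assms f_eq differentiable_coeffs(1,2)[OF assms]]
  by simp

text \<open>An acceleration direction leaves the arguments of \<open>g\<close> and \<open>h\<close>
  fixed, so only the linear factor is differentiated. Hence symmetry of \<open>g\<close> is exactly
  the symmetry of the acceleration derivatives of \<open>f\<close>.\<close>

lemma pd2_qdd_f:
  assumes "x \<in> S"
  shows "pd2_qdd b (f a) (p, x) = g a b x"
proof -
  have 0: "pd (0, 0, 0) K x = 0" if "K differentiable (at x)" for K
    using linear_0[OF linear_pd[OF that]] by (simp add: zero_prod_def)
  have "pd2_qdd b (f a) (p, x) = (\<Sum>c\<in>UNIV. g a c x * axis b 1 $ c)"
    using pd_affine[where F = "f a" and w = "axis b 1" and v = "(0, 0, 0)",
        OF open_S assms f_eq differentiable_coeffs(1,2)[OF assms]]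
    by (simp add: pd2_qdd_def 0 differentiable_coeffs[OF assms])
  then show ?thesis
    by (simp add: sum_mult_axis)
qed

text \<open>Coefficients of \<open>qdd\<close> and the remainder in \<open>\<partial>f\<^sub>b/\<partial>qd\<^sup>a - \<partial>f\<^sub>a/\<partial>qd\<^sup>b\<close>.\<close>

definition curl_g :: "'n \<Rightarrow> 'n \<Rightarrow> 'n \<Rightarrow> 'n jet1 \<Rightarrow> real" where
  "curl_g a b c y = pd1_qd a (g b c) y - pd1_qd b (g a c) y"

definition curl_h :: "'n \<Rightarrow> 'n \<Rightarrow> 'n jet1 \<Rightarrow> real" where
  "curl_h a b y = pd1_qd a (h b) y - pd1_qd b (h a) y"

lemma curl_differentiable:
  assumes "x \<in> S"
  shows "curl_g a b c differentiable (at x)" "curl_h a b differentiable (at x)"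
  unfolding curl_g_def[abs_def] curl_h_def[abs_def] pd1_qd_def
  by (intro differentiable_diff differentiable_coeffs assms)+

text \<open>The velocity curl of \<open>f\<close> is again affine in the acceleration, with
  coefficients \<open>curl_g\<close> and \<open>curl_h\<close>. Differentiating it along the total
  direction shows that \<open>w\<close> enters only through \<open>curl_g\<close>.\<close>

lemma r_fun_eq:
  assumes "x \<in> S"
  shows "r_fun f a b (w, p, x) =
      (\<Sum>c\<in>UNIV. (pd1_q b (g a c) x - pd1_q a (g b c) x) * p $ c)
      + pd1_q b (h a) x - pd1_q a (h b) x
      + 1 / 2 * ((\<Sum>c\<in>UNIV. pd (p, fst x, 1) (curl_g a b c) x * p $ c + curl_g a b c x * w $ c)
                 + pd (p, fst x, 1) (curl_h a b) x)"
proof -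
  let ?F = "\<lambda>y. pd2_qd a (f b) y - pd2_qd b (f a) y"
  have F: "?F (p, y) = (\<Sum>c\<in>UNIV. curl_g a b c y * p $ c) + curl_h a b y" if "y \<in> S" for p y
    using that
    by (simp add: pd2_qd_def pd_f curl_g_def curl_h_def pd1_qd_def left_diff_distrib sum_subtractf)
  have "total_deriv ?F (w, p, x) = pd (w, p, fst x, 1) ?F (p, x)"
    by (rule total_deriv_eq_pd[OF affine_differentiable[where F = ?F, OF open_S assms F]])
       (use assms curl_differentiable in auto)
  also have "\<dots> = (\<Sum>c\<in>UNIV. pd (p, fst x, 1) (curl_g a b c) x * p $ c + curl_g a b c x * w $ c)
      + pd (p, fst x, 1) (curl_h a b) x"
    by (rule pd_affine[where F = ?F, OF open_S assms F]) (use assms curl_differentiable in auto)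
  finally show ?thesis
    using assms
    by (simp add: r_fun_def pd2_q_def pd_f pd1_q_def left_diff_distrib sum_subtractf)
qed

text \<open>The function under the total derivative is \<open>g b a\<close>, already of first order,
  so \<open>w\<close> drops out and \<open>p\<close> enters linearly.\<close>

lemma s_fun_eq:
  assumes "x \<in> S"
  shows "s_fun f a b (w, p, x) =
      1 / 2 * (pd1_qd b (h a) x + pd1_qd a (h b) x) - drift (g a b) x
      + (\<Sum>c\<in>UNIV. (1 / 2 * (pd1_qd b (g a c) x + pd1_qd a (g b c) x) - pd1_qd c (g a b) x) * p $ c)"
proof -
  let ?F = "pd2_qdd a (f b)"
  \<comment> \<open>Written as an affine function with zero linear coefficients, so that the rules
    for affine functions apply.\<close>
  have F: "?F (p, y) = (\<Sum>c\<in>(UNIV::'n set). 0 * p $ c) + g a b y" if "y \<in> S" for p y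
    using that by (simp add: pd2_qdd_f g_sym[of _ a b])
  have "total_deriv ?F (w, p, x) = pd (w, p, fst x, 1) ?F (p, x)"
    by (rule total_deriv_eq_pd[OF affine_differentiable[where F = ?F, OF open_S assms F]])
       (use assms differentiable_coeffs in auto)
  also have "\<dots> = pd (p, fst x, 1) (g a b) x"
    using pd_affine[where F = ?F, OF open_S assms F, of w "(p, fst x, 1)" p]
      differentiable_coeffs[OF assms] by (simp add: pd_const)
  also have "\<dots> = drift (g a b) x + (\<Sum>c\<in>UNIV. p $ c * pd1_qd c (g a b) x)"
    by (rule pd_total_direction[OF differentiable_coeffs(1)[OF assms]])
  finally show ?thesis
    using assms
    by (simp add: s_fun_def pd2_qd_def pd_f pd1_qd_def algebra_simps add_divide_distrib
        sum.distrib sum_subtractf sum_divide_distrib)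
qed

section \<open>First-order parts of r and s\<close>

definition r0 :: "'n \<Rightarrow> 'n \<Rightarrow> 'n jet1 \<Rightarrow> real" where
  "r0 a b x = pd1_q b (h a) x - pd1_q a (h b) x
     + 1 / 2 * (drift (pd1_qd a (h b)) x - drift (pd1_qd b (h a)) x)"

definition s0 :: "'n \<Rightarrow> 'n \<Rightarrow> 'n jet1 \<Rightarrow> real" where
  "s0 a b x = 1 / 2 * (pd1_qd b (h a) x + pd1_qd a (h b) x) - drift (g a b) x"

text \<open>The coefficient of \<open>qdd\<^sup>c\<close> in \<open>r\<^sub>a\<^sub>b\<close> once \<open>curl_g\<close> vanishes; \<open>r0\<close> and \<open>s0\<close> are then the
  parts of \<open>r\<close> and \<open>s\<close> of order zero in \<open>qdd\<close>.\<close>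

definition defect :: "'n \<Rightarrow> 'n \<Rightarrow> 'n \<Rightarrow> 'n jet1 \<Rightarrow> real" where
  "defect a b c x = pd1_q b (g a c) x - pd1_q a (g b c) x
     + 1 / 2 * (pd1_qd c (pd1_qd a (h b)) x - pd1_qd c (pd1_qd b (h a)) x)"

text \<open>After the velocity derivatives are reordered, twice the defect is the right side minus
  the left side of this equation.\<close>

lemma defect_eq_0_iff:
  assumes "x \<in> S"
  shows "defect a b c x = 0 \<longleftrightarrow>
    pd1_qd b (pd1_qd c (h a)) x - pd1_qd a (pd1_qd c (h b)) x
      = 2 * (pd1_q b (g a c) x - pd1_q a (g b c) x)"
proof -
  have "pd1_qd c (pd1_qd a (h b)) x = pd1_qd a (pd1_qd c (h b)) x" for a b
    unfolding pd1_qd_def by (rule pd_commute[OF open_S smooth_h assms])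
  then show ?thesis
    unfolding defect_def by (auto simp: algebra_simps)
qed

text \<open>Vanishing of \<open>curl_g\<close> on the open set \<open>S\<close> also kills its
  derivatives, hence the terms of \<open>r_fun_eq\<close> quadratic in \<open>p\<close>. The
  remaining linear terms come from the \<open>q\<close>-derivatives of \<open>g\<close> and from
  \<open>curl_h\<close>.\<close>

lemma r_fun_curl_free:
  assumes "x \<in> S" and curl: "\<And>a b c y. y \<in> S \<Longrightarrow> curl_g a b c y = 0"
  shows "r_fun f a b (w, p, x) = r0 a b x + (\<Sum>c\<in>UNIV. defect a b c x * p $ c)"
proof -
  have pdG: "pd v (curl_g a b c) x = 0" for v c
    by (rule pd_eq_0_on_open[OF open_S assms(1) curl])
  have pdH: "pd v (curl_h a b) x = pd v (pd1_qd a (h b)) x - pd v (pd1_qd b (h a)) x" for v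
    unfolding curl_h_def[abs_def] pd1_qd_def by (intro pd_diff differentiable_coeffs assms(1))
  have "pd1_qd c (curl_h a b) x = pd1_qd c (pd1_qd a (h b)) x - pd1_qd c (pd1_qd b (h a)) x" for c
    unfolding pd1_qd_def[of c] by (rule pdH)
  with pdH have pdH_total: "pd (p, fst x, 1) (curl_h a b) x = drift (pd1_qd a (h b)) x - drift (pd1_qd b (h a)) x
      + (\<Sum>c\<in>UNIV. p $ c * (pd1_qd c (pd1_qd a (h b)) x - pd1_qd c (pd1_qd b (h a)) x))"
    using pd_total_direction[OF curl_differentiable(2)[OF assms(1)], of p a b]
    by (simp add: drift_def)
  show ?thesis
    using assms
    by (simp add: pdG pdH_total r_fun_eq r0_def defect_def algebra_simps add_divide_distrib diff_divide_distrib
        sum.distrib sum_subtractf sum_divide_distrib)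
qed

text \<open>Together with symmetry of \<open>g\<close>, vanishing curl makes the velocity
  derivatives of \<open>g\<close> totally symmetric in three indices, and each coefficient of
  \<open>p\<close> in \<open>s_fun_eq\<close> cancels.\<close>

lemma s_fun_curl_free:
  assumes "x \<in> S" and curl: "\<And>a b c y. y \<in> S \<Longrightarrow> curl_g a b c y = 0"
  shows "s_fun f a b (w, p, x) = s0 a b x"
proof -
  have "pd1_qd b (g a c) x = pd1_qd c (g a b) x" "pd1_qd a (g b c) x = pd1_qd c (g a b) x" for c
    using curl[OF assms(1), of b c a] curl[OF assms(1), of a c b] pd_g_sym[OF assms(1)]
    unfolding curl_g_def pd1_qd_def by (metis eq_iff_diff_eq_0)+
  then show ?thesis
    using assms(1) by (simp add: s_fun_eq s0_def)
qed

text \<open>All terms under \<open>drift\<close> add up to the drift of \<open>defect\<close>, which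
  is zero. What survives are mixed \<open>q\<close> and \<open>qd\<close> derivatives of
  \<open>h\<close>, including the commutator terms of \<open>pd_drift\<close>, and they form the
  cyclic sum.\<close>

lemma pd_r0_s0:
  assumes "x \<in> S" and defect: "\<And>a b c y. y \<in> S \<Longrightarrow> defect a b c y = 0"
  shows "2 * (pd1_qd c (r0 a b) x - (pd1_q b (s0 a c) x - pd1_q a (s0 b c) x))
    = cyclic_sum (\<lambda>a b c. pd1_q b (pd1_qd c (h a)) x - pd1_q c (pd1_qd b (h a)) x) a b c"
proof -
  note d = differentiable_coeffs[OF assms(1)]
  have dd: "drift (pd v (h a)) differentiable (at x)" "drift (g a b) differentiable (at x)" for v a b
    by (intro drift_differentiable[OF open_S _ assms(1)] smooth_pd_h smooth_g)+
  have drift_h: "pd u (drift (pd v (h a))) x = drift (pd u (pd v (h a))) x + pd (0, fst u, 0) (pd v (h a)) x"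
    for u v a
    by (rule pd_drift[OF open_S smooth_pd_h assms(1)])
  \<comment> \<open>The direction \<open>(0, axis b 1, 0)\<close> has no velocity component, so the
    commutator term of \<open>pd_drift\<close> vanishes.\<close>
  have drift_g: "pd1_q b (drift (g a c)) x = drift (pd1_q b (g a c)) x" for a b c
    using pd_drift[OF open_S smooth_g assms(1), of "(0, axis b 1, 0)" a c]
      linear_0[OF linear_pd[OF d(1)[of a c]]]
    by (simp add: pd1_q_def zero_prod_def)
  have r: "pd1_qd c (r0 a b) x = pd1_qd c (pd1_q b (h a)) x - pd1_qd c (pd1_q a (h b)) x
    + 1 / 2 * (drift (pd1_qd c (pd1_qd a (h b))) x + pd1_q c (pd1_qd a (h b)) x
         - drift (pd1_qd c (pd1_qd b (h a))) x - pd1_q c (pd1_qd b (h a)) x)"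
    unfolding r0_def[abs_def] pd1_qd_def pd1_q_def
    by (simp add: pd_add pd_diff pd_divide d dd drift_h)
  have s: "pd1_q b (s0 a c) x = 1 / 2 * (pd1_q b (pd1_qd c (h a)) x + pd1_q b (pd1_qd a (h c)) x)
      - drift (pd1_q b (g a c)) x" for a b c
    unfolding s0_def[abs_def] drift_g[symmetric] unfolding pd1_qd_def pd1_q_def
    by (simp add: pd_add pd_diff pd_divide d dd)
  have "drift (defect a b c) x = 0"
    unfolding drift_def by (rule pd_eq_0_on_open[OF open_S assms(1) defect])
  then have e: "drift (pd1_q b (g a c)) x - drift (pd1_q a (g b c)) x
      + 1 / 2 * (drift (pd1_qd c (pd1_qd a (h b))) x - drift (pd1_qd c (pd1_qd b (h a))) x) = 0"
    unfolding defect_def[abs_def] pd1_qd_def pd1_q_def drift_def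
    by (simp add: pd_add pd_diff pd_divide d)
  have comm: "pd1_qd c (pd1_q b (h a)) x = pd1_q b (pd1_qd c (h a)) x" for a b c
    unfolding pd1_qd_def pd1_q_def by (rule pd_commute[OF open_S smooth_h assms(1)])
  show ?thesis
    using e unfolding r s cyclic_sum_def comm by (simp add: field_simps)
qed

text \<open>The conditions match in two stages: being of first order amounts to the first two
  conditions on \<open>(g, h)\<close>, and once these hold the derivative identity amounts to the
  cyclic one.\<close>

lemma conditions_iff:
  "((\<forall>a b. first_order_on (UNIV \<times> UNIV \<times> S) (r_fun f a b)
          \<and> first_order_on (UNIV \<times> UNIV \<times> S) (s_fun f a b))
    \<and> (\<forall>a b c. \<forall>x\<in>UNIV \<times> UNIV \<times> S.
          pd3_qd c (r_fun f a b) x = pd3_q b (s_fun f a c) x - pd3_q a (s_fun f b c) x))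
   \<longleftrightarrow>
   ((\<forall>a b c. \<forall>x\<in>S. pd1_qd c (g a b) x - pd1_qd b (g a c) x = 0)
    \<and> (\<forall>a b c. \<forall>x\<in>S. pd1_qd b (pd1_qd c (h a)) x - pd1_qd a (pd1_qd c (h b)) x
          = 2 * (pd1_q b (g a c) x - pd1_q a (g b c) x))
    \<and> (\<forall>a b c. \<forall>x\<in>S.
          cyclic_sum (\<lambda>a b c. pd1_q b (pd1_qd c (h a)) x - pd1_q c (pd1_qd b (h a)) x) a b c = 0))"
  (is "?fo \<and> ?pd \<longleftrightarrow> ?B1 \<and> ?B2 \<and> ?B3")
proof -
  have B1: "?B1 \<longleftrightarrow> (\<forall>a b c. \<forall>x\<in>S. curl_g a b c x = 0)"
    unfolding curl_g_def pd1_qd_def using pd_g_sym by (metis eq_iff_diff_eq_0)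
  have B2: "?B2 \<longleftrightarrow> (\<forall>a b c. \<forall>x\<in>S. defect a b c x = 0)"
    by (simp add: defect_eq_0_iff)
  have fo: "?fo \<longleftrightarrow> ?B1 \<and> ?B2"
  proof
    assume fo: ?fo
    have eq: "r_fun f a b (w, p, x) = r_fun f a b (w', p', x)" if "x \<in> S" for a b w p w' p' x
      using fo that unfolding first_order_on_def by (cases x) auto
    \<comment> \<open>At \<open>p = 0\<close>, comparing \<open>w\<close> equal to a basis vector
      with \<open>w = 0\<close> isolates one coefficient of \<open>w\<close> in
      \<open>r_fun_eq\<close>.\<close>
    have curl: "curl_g a b d x = 0" if "x \<in> S" for a b d x
      using eq[OF that, of a b "axis d 1" 0 0 0] r_fun_eq[OF that, of a b _ 0]
      by (simp add: sum_mult_axis)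
    \<comment> \<open>With the curl gone, the same comparison in \<open>p\<close> isolates one
      coefficient of the acceleration.\<close>
    have "defect a b d x = 0" if "x \<in> S" for a b d x
      using eq[OF that, of a b 0 "axis d 1" 0 0] r_fun_curl_free[OF that curl]
      by (simp add: sum_mult_axis)
    with curl show "?B1 \<and> ?B2"
      unfolding B1 B2 by blast
  next
    assume "?B1 \<and> ?B2"
    then show ?fo
      unfolding B1 B2 first_order_on_def by (auto simp: r_fun_curl_free s_fun_curl_free)
  qed
  have pd: "?pd \<longleftrightarrow> ?B3" if "?B1 \<and> ?B2"
  proof -
    have curl: "\<And>a b c x. x \<in> S \<Longrightarrow> curl_g a b c x = 0"
      and defect: "\<And>a b c x. x \<in> S \<Longrightarrow> defect a b c x = 0"
      using that unfolding B1 B2 by blast+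
    \<comment> \<open>A derivative along first-order coordinates keeps \<open>(w, p)\<close> frozen,
      so it can be computed on the first-order jet space.\<close>
    have lift: "pd (0, 0, v) F (w, p, x) = pd v G x"
      if "x \<in> S" "\<And>y. y \<in> S \<Longrightarrow> F (w, p, y) = G y" for F G v w p x
    proof -
      have "pd (0, 0, v) F (w, p, x) = pd v (\<lambda>y. F (w, p, y)) x"
        by (simp add: pd_def)
      then show ?thesis
        using pd_cong[OF open_S that(1), of "\<lambda>y. F (w, p, y)" G v] that(2) by simp
    qed
    have r: "pd3_qd c (r_fun f a b) (w, p, x) = pd1_qd c (r0 a b) x" if "x \<in> S" for a b c w p x
      unfolding pd3_qd_def pd1_qd_def
      by (rule lift[OF that]) (simp add: r_fun_curl_free curl defect)
    have s: "pd3_q c (s_fun f a b) (w, p, x) = pd1_q c (s0 a b) x" if "x \<in> S" for a b c w p x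
      unfolding pd3_q_def pd1_q_def
      by (rule lift[OF that]) (simp add: s_fun_curl_free curl)
    have half: "k = 0 \<longleftrightarrow> u = v" if "2 * (u - v) = k" for k u v :: real
      using that by auto
    have "cyclic_sum (\<lambda>a b c. pd1_q b (pd1_qd c (h a)) x - pd1_q c (pd1_qd b (h a)) x) a b c = 0
        \<longleftrightarrow> pd1_qd c (r0 a b) x = pd1_q b (s0 a c) x - pd1_q a (s0 b c) x" if "x \<in> S" for a b c x
      by (rule half[OF pd_r0_s0[OF that defect]])
    then show ?thesis
      by (auto simp: r s)
  qed
  show ?thesis
    using fo pd by blast
qed

end

section \<open>Reduction to affine forces and the equivalence\<close>

lemma force_affine:
  fixes f :: "'n::finite \<Rightarrow> 'n jet2 \<Rightarrow> real"
  assumes S: "open S" and f: "\<And>a. smooth_on (UNIV \<times> S) (f a)"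
    and fo: "\<And>a b. first_order_on (UNIV \<times> UNIV \<times> S) (s_fun f a b)" and "x \<in> S"
  shows "f b (p, x) = (\<Sum>c\<in>UNIV. pd2_qdd c (f b) (0, x) * p $ c) + f b (0, x)"
proof (rule affine_of_second_derivative_zero[OF S f \<open>x \<in> S\<close>])
  fix a c p
  obtain qd q t where x: "x = (qd, q, t)"
    by (metis prod.exhaust)
  \<comment> \<open>Only the last sum of \<open>total_deriv\<close> contains \<open>w\<close>; the
    two values of \<open>s_fun\<close> differ by a single second derivative in the
    acceleration.\<close>
  have "s_fun f a b (axis c 1, p, x) = s_fun f a b (0, p, x)"
    using fo \<open>x \<in> S\<close> unfolding first_order_on_def x by blast
  then have "(\<Sum>d\<in>UNIV. pd2_qdd d (pd2_qdd a (f b)) (p, x) * axis c 1 $ d) = 0"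
    by (simp add: s_fun_def x mult.commute)
  then show "pd2_qdd c (pd2_qdd a (f b)) (p, x) = 0"
    by (simp add: sum_mult_axis)
qed

theorem mainTheorem3:
  fixes U :: "(real ^ 'n::finite) set" and I :: "real set"
    and f :: "'n \<Rightarrow> 'n jet2 \<Rightarrow> real"
  assumes "open U" and "open I" and "is_interval I"
    and "\<And>a. smooth_on (jet2_dom U I) (f a)"
  shows
    "((\<forall>a b. first_order_on (jet3_dom U I) (r_fun f a b)
            \<and> first_order_on (jet3_dom U I) (s_fun f a b))
      \<and> (\<forall>a b. \<forall>x\<in>jet2_dom U I. pd2_qdd b (f a) x = pd2_qdd a (f b) x)
      \<and> (\<forall>a b c. \<forall>x\<in>jet3_dom U I.
            pd3_qd c (r_fun f a b) x = pd3_q b (s_fun f a c) x - pd3_q a (s_fun f b c) x))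
     \<longleftrightarrow>
     (\<exists>(g :: 'n \<Rightarrow> 'n \<Rightarrow> 'n jet1 \<Rightarrow> real) (h :: 'n \<Rightarrow> 'n jet1 \<Rightarrow> real).
        (\<forall>a b. smooth_on (jet1_dom U I) (g a b))
      \<and> (\<forall>a. smooth_on (jet1_dom U I) (h a))
      \<and> (\<forall>a. \<forall>(qdd, x)\<in>jet2_dom U I. f a (qdd, x) = (\<Sum>b\<in>UNIV. g a b x * qdd $ b) + h a x)
      \<and> (\<forall>a b. \<forall>x\<in>jet1_dom U I. g a b x = g b a x)
      \<and> (\<forall>a b c. \<forall>x\<in>jet1_dom U I. pd1_qd c (g a b) x - pd1_qd b (g a c) x = 0)
      \<and> (\<forall>a b c. \<forall>x\<in>jet1_dom U I.
            pd1_qd b (pd1_qd c (h a)) x - pd1_qd a (pd1_qd c (h b)) x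
            = 2 * (pd1_q b (g a c) x - pd1_q a (g b c) x))
      \<and> (\<forall>a b c. \<forall>x\<in>jet1_dom U I.
            cyclic_sum (\<lambda>a b c. pd1_q b (pd1_qd c (h a)) x - pd1_q c (pd1_qd b (h a)) x) a b c = 0))"
proof -
  define S where "S = jet1_dom U I"
  have S: "open S"
    using assms(1,2) unfolding S_def jet1_dom_def by (intro open_Times) auto
  have J: "jet1_dom U I = S" "jet2_dom U I = UNIV \<times> S" "jet3_dom U I = UNIV \<times> UNIV \<times> S"
    by (simp_all add: S_def jet2_dom_def jet3_dom_def)
  have f: "smooth_on (UNIV \<times> S) (f a)" for a
    using assms(4) J by simp
  show ?thesis
    unfolding J
  proof
    assume A: "(\<forall>a b. first_order_on (UNIV \<times> UNIV \<times> S) (r_fun f a b)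
            \<and> first_order_on (UNIV \<times> UNIV \<times> S) (s_fun f a b))
      \<and> (\<forall>a b. \<forall>x\<in>UNIV \<times> S. pd2_qdd b (f a) x = pd2_qdd a (f b) x)
      \<and> (\<forall>a b c. \<forall>x\<in>UNIV \<times> UNIV \<times> S.
            pd3_qd c (r_fun f a b) x = pd3_q b (s_fun f a c) x - pd3_q a (s_fun f b c) x)"
    \<comment> \<open>The witnesses are the Taylor coefficients of \<open>f\<close> at zero
      acceleration, as delivered by \<open>force_affine\<close>.\<close>
    define g where "g a b x = pd2_qdd b (f a) (0, x)" for a b x
    define h where "h a x = f a (0, x)" for a x
    \<comment> \<open>The embedding of \<open>x\<close> as \<open>(0, x)\<close> is linear, so
      smoothness of the witnesses is inherited from \<open>f\<close> and its derivatives.\<close>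
    have restrict: "smooth_on S (\<lambda>x. F (0, x))" if "smooth_on (UNIV \<times> S) F" for F :: "'n jet2 \<Rightarrow> real"
      by (rule smooth_on_compose_linear[OF that S]) (auto intro!: bounded_linear_intros)
    interpret affine_force S f g h
    proof
      show "open S" by (rule S)
      show "smooth_on S (g a b)" for a b
        unfolding g_def[abs_def] pd2_qdd_def
        using S by (intro restrict smooth_on_pd f open_Times) auto
      show "smooth_on S (h a)" for a
        unfolding h_def[abs_def] by (intro restrict f)
      show "f a (p, x) = (\<Sum>b\<in>UNIV. g a b x * p $ b) + h a x" if "x \<in> S" for a p x
        unfolding g_def h_def using A by (intro force_affine[where f = f, OF S f _ that]) blast
      show "g a b x = g b a x" if "x \<in> S" for a b x
        unfolding g_def using A that by blast
    qed
    note B = iffD1[OF conditions_iff conjI[OF conjunct1[OF A] conjunct2[OF conjunct2[OF A]]]]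
    show "\<exists>g h. (\<forall>a b. smooth_on S (g a b)) \<and> (\<forall>a. smooth_on S (h a))
      \<and> (\<forall>a. \<forall>(qdd, x)\<in>UNIV \<times> S. f a (qdd, x) = (\<Sum>b\<in>UNIV. g a b x * qdd $ b) + h a x)
      \<and> (\<forall>a b. \<forall>x\<in>S. g a b x = g b a x)
      \<and> (\<forall>a b c. \<forall>x\<in>S. pd1_qd c (g a b) x - pd1_qd b (g a c) x = 0)
      \<and> (\<forall>a b c. \<forall>x\<in>S. pd1_qd b (pd1_qd c (h a)) x - pd1_qd a (pd1_qd c (h b)) x
            = 2 * (pd1_q b (g a c) x - pd1_q a (g b c) x))
      \<and> (\<forall>a b c. \<forall>x\<in>S.
            cyclic_sum (\<lambda>a b c. pd1_q b (pd1_qd c (h a)) x - pd1_q c (pd1_qd b (h a)) x) a b c = 0)"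
    proof (intro exI conjI)
      show "\<forall>a. \<forall>(qdd, x)\<in>UNIV \<times> S. f a (qdd, x) = (\<Sum>b\<in>UNIV. g a b x * qdd $ b) + h a x"
        using f_eq by auto
      show "\<forall>a b. \<forall>x\<in>S. g a b x = g b a x"
        by (intro allI ballI g_sym)
    qed (use smooth_g smooth_h B in blast)+
  next
    assume "\<exists>g h. (\<forall>a b. smooth_on S (g a b)) \<and> (\<forall>a. smooth_on S (h a))
      \<and> (\<forall>a. \<forall>(qdd, x)\<in>UNIV \<times> S. f a (qdd, x) = (\<Sum>b\<in>UNIV. g a b x * qdd $ b) + h a x)
      \<and> (\<forall>a b. \<forall>x\<in>S. g a b x = g b a x)
      \<and> (\<forall>a b c. \<forall>x\<in>S. pd1_qd c (g a b) x - pd1_qd b (g a c) x = 0)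
      \<and> (\<forall>a b c. \<forall>x\<in>S. pd1_qd b (pd1_qd c (h a)) x - pd1_qd a (pd1_qd c (h b)) x
            = 2 * (pd1_q b (g a c) x - pd1_q a (g b c) x))
      \<and> (\<forall>a b c. \<forall>x\<in>S.
            cyclic_sum (\<lambda>a b c. pd1_q b (pd1_qd c (h a)) x - pd1_q c (pd1_qd b (h a)) x) a b c = 0)"
    then obtain g h where sm: "\<forall>a b. smooth_on S (g a b)" "\<forall>a. smooth_on S (h a)"
      and feq: "\<forall>a. \<forall>(qdd, x)\<in>UNIV \<times> S. f a (qdd, x) = (\<Sum>b\<in>UNIV. g a b x * qdd $ b) + h a x"
      and sym: "\<forall>a b. \<forall>x\<in>S. g a b x = g b a x"
      and B1: "\<forall>a b c. \<forall>x\<in>S. pd1_qd c (g a b) x - pd1_qd b (g a c) x = 0"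
      and B2: "\<forall>a b c. \<forall>x\<in>S. pd1_qd b (pd1_qd c (h a)) x - pd1_qd a (pd1_qd c (h b)) x
            = 2 * (pd1_q b (g a c) x - pd1_q a (g b c) x)"
      and B3: "\<forall>a b c. \<forall>x\<in>S.
            cyclic_sum (\<lambda>a b c. pd1_q b (pd1_qd c (h a)) x - pd1_q c (pd1_qd b (h a)) x) a b c = 0"
      by (elim exE conjE) (rule that)
    interpret affine_force S f g h
    proof
      show "g a b x = g b a x" if "x \<in> S" for a b x
        using sym that by blast
    qed (use S sm feq in auto)
    \<comment> \<open>The symmetry condition is kept outside \<open>conditions_iff\<close> and is
      read off from \<open>g\<close> here.\<close>
    have "\<forall>a b. \<forall>x\<in>UNIV \<times> S. pd2_qdd b (f a) x = pd2_qdd a (f b) x"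
      by (auto simp: pd2_qdd_f intro: g_sym)
    then show "(\<forall>a b. first_order_on (UNIV \<times> UNIV \<times> S) (r_fun f a b)
            \<and> first_order_on (UNIV \<times> UNIV \<times> S) (s_fun f a b))
      \<and> (\<forall>a b. \<forall>x\<in>UNIV \<times> S. pd2_qdd b (f a) x = pd2_qdd a (f b) x)
      \<and> (\<forall>a b c. \<forall>x\<in>UNIV \<times> UNIV \<times> S.
            pd3_qd c (r_fun f a b) x = pd3_q b (s_fun f a c) x - pd3_q a (s_fun f b c) x)"
      using conditions_iff B1 B2 B3 by blast
  qed
qed

end
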